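(* Let $A\in\mathbb{R}^{n\times n}$, $C=I\in\mathbb{R}^{n\times n}$, $N\ge 1$, let $O$ be the observability matrix and $W_o=O^\top O\in\mathbb{R}^{n\times n}$ the observability Gramian over horizon $N$. Let $L:=W_o$ and $\mathcal{Y}=\{1,\dots,n\}$. Let $o_i$ denote the $i$-th column of $O$. Then $L\succeq 0$, and the L-ensemble $\mathcal{P}_L$ is a valid probability measure on $2^{\mathcal{Y}}$ that satisfies, for every $Y\subseteq\mathcal{Y}$, $$\mathcal{P}_L(Y)=\frac{\det((W_o)_Y)}{\det(W_o+I)}=\frac{\mathrm{Vol}^2\big(\{o_i\}_{i\in Y}\big)}{\det(W_o+I)}.$$ Moreover, $\mathcal{P}_L(Y)>0$ if and only if the columns $\{o_i\}_{i\in Y}$ are linearly independent, and the system $x[k+1]=Ax[k]+Bu[k]$, $y[k]=Cx[k]$ is observable over the horizon $N$ if and only if $\mathcal{P}_L(Y)>0$ for every $Y\subseteq\mathcal{Y}$.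
   Context: For a discrete-time linear system $x[k+1]=Ax[k]+Bu[k]$, $y[k]=Cx[k]$ with $A\in\mathbb{R}^{n\times n}$, $C\in\mathbb{R}^{p\times n}$ and horizon $N\ge 1$, the observability matrix is $O=[C^\top,(CA)^\top,\dots,(CA^{N-1})^\top]^\top\in\mathbb{R}^{Np\times n}$ and the observability Gramian is $W_o=\sum_{k=0}^{N-1}(A^k)^\top C^\top C A^k=O^\top O$. The system is observable over the horizon $N$ iff $\mathrm{rank}(O)=n$. Here $C=I$, so $p=n$ and every state variable is a candidate node. For a matrix $M$ and an index set $Y$, $M_Y=[M_{ij}]_{i,j\in Y}$ is the principal submatrix, with $\det(M_\emptyset)=1$. For $L\succeq 0$ (symmetric) indexed by $\mathcal{Y}$, the L-ensemble determinantal point process (DPP) $\mathcal{P}_L$ on $2^{\mathcal{Y}}$ is $\mathcal{P}_L(Y)=\det(L_Y)/\sum_{Y'\subseteq\mathcal{Y}}\det(L_{Y'})$. $\mathrm{Vol}(\{o_i\}_{i\in Y})$ is the $|Y|$-dimensional volume of the parallelepiped spanned by the vectors $o_i$, $i\in Y$ (equal to $0$ if they are linearly dependent and to $1$ if $Y=\emptyset$). *)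

theory Defs
  imports
    "HOL-Probability.Probability_Measure"
    "Jordan_Normal_Form.DL_Rank"
    "Jordan_Normal_Form.DL_Submatrix"
begin

text \<open>
  Dimensions are natural numbers, so matrices and vectors are the carrier-based ones of
  \<^theory>\<open>Jordan_Normal_Form.Matrix\<close>; indices start at 0, and the ground set
  \<open>{1, \<dots>, n}\<close> becomes \<open>{..<n}\<close>.
\<close>

text \<open>Row \<open>k * p + r\<close> of the observability matrix is row \<open>r\<close> of the block \<open>C A\<^sup>k\<close>,
  where \<open>p\<close> is the number of rows of \<open>C\<close> and \<open>k < N\<close>.\<close>

definition obs_matrix :: "nat \<Rightarrow> real mat \<Rightarrow> real mat \<Rightarrow> real mat" where
  "obs_matrix N A C =
     mat (N * dim_row C) (dim_row A)
       (\<lambda>(i, j). (C * A ^\<^sub>m (i div dim_row C)) $$ (i mod dim_row C, j))"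

definition obs_gramian :: "nat \<Rightarrow> real mat \<Rightarrow> real mat \<Rightarrow> real mat" where
  "obs_gramian N A C = transpose_mat (obs_matrix N A C) * obs_matrix N A C"

text \<open>The input matrix \<open>B\<close> plays no role in observability.\<close>

definition observable :: "nat \<Rightarrow> real mat \<Rightarrow> real mat \<Rightarrow> bool" where
  "observable N A C \<longleftrightarrow>
     vec_space.rank (N * dim_row C) (obs_matrix N A C) = dim_row A"

text \<open>Agreement with the usual formula for the Gramian, stated entrywise because the
  matrix type has no sum operator.\<close>

lemma obs_gramian_eq_sum:
  assumes A: "A \<in> carrier_mat n n" and C: "C \<in> carrier_mat p n" and i: "i < n" and j: "j < n"
  shows "obs_gramian N A C $$ (i, j) =
    (\<Sum>k<N. (transpose_mat (A ^\<^sub>m k) * transpose_mat C * C * A ^\<^sub>m k) $$ (i, j))"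
proof -
  have Ak: "A ^\<^sub>m k \<in> carrier_mat n n" for k using A by simp
  define f where "f k r = (C * A ^\<^sub>m k) $$ (r, i) * (C * A ^\<^sub>m k) $$ (r, j)" for k r
  have "obs_gramian N A C $$ (i, j) = (\<Sum>l<N * p. f (l div p) (l mod p))"
    using A C i j by (simp add: obs_gramian_def obs_matrix_def scalar_prod_def f_def
        atLeast0LessThan)
  also have "\<dots> = (\<Sum>k<N. \<Sum>l = k * p..<k * p + p. f (l div p) (l mod p))"
    by (simp add: sum.nat_group)
  also have "\<dots> = (\<Sum>k<N. \<Sum>r<p. f k r)"
  proof (rule sum.cong)
    fix k
    show "(\<Sum>l = k * p..<k * p + p. f (l div p) (l mod p)) = (\<Sum>r<p. f k r)"
      using sum.shift_bounds_nat_ivl[of "\<lambda>l. f (l div p) (l mod p)" 0 "k * p" p]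
      by (simp add: atLeast0LessThan add.commute)
  qed simp
  also have "\<dots> = (\<Sum>k<N. (transpose_mat (A ^\<^sub>m k) * transpose_mat C * C * A ^\<^sub>m k) $$ (i, j))"
  proof (rule sum.cong)
    fix k
    have "transpose_mat (A ^\<^sub>m k) * transpose_mat C * C * A ^\<^sub>m k
        = transpose_mat (C * A ^\<^sub>m k) * (C * A ^\<^sub>m k)"
      using Ak[of k] C
      by (subst transpose_mult[of C p n _ n], simp, simp,
          subst assoc_mult_mat[of "transpose_mat (A ^\<^sub>m k) * transpose_mat C" n p C n _ n])
        auto
    moreover have "(transpose_mat M * M) $$ (i, j) = (\<Sum>r<p. M $$ (r, i) * M $$ (r, j))"
      if "M \<in> carrier_mat p n" for M :: "real mat"
      using that i j by (simp add: scalar_prod_def atLeast0LessThan)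
    moreover have "C * A ^\<^sub>m k \<in> carrier_mat p n" using Ak[of k] C by simp
    ultimately show "(\<Sum>r<p. f k r) =
        (transpose_mat (A ^\<^sub>m k) * transpose_mat C * C * A ^\<^sub>m k) $$ (i, j)" unfolding f_def by metis
  qed simp
  finally show ?thesis .
qed

definition pos_semidef :: "real mat \<Rightarrow> bool" where
  "pos_semidef L \<longleftrightarrow>
     square_mat L \<and> transpose_mat L = L \<and>
     (\<forall>x \<in> carrier_vec (dim_row L). 0 \<le> x \<bullet> (L *\<^sub>v x))"

definition principal_submatrix :: "real mat \<Rightarrow> nat set \<Rightarrow> real mat" where
  "principal_submatrix M Y = submatrix M Y Y"

text \<open>The mass function is the plain real quotient, so that nonnegativity is a claim about it;
  the measure below would silently truncate negative values.\<close>

definition l_ensemble_mass :: "real mat \<Rightarrow> nat set \<Rightarrow> real" where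
  "l_ensemble_mass L Y =
     det (principal_submatrix L Y) / (\<Sum>Z \<in> Pow {..<dim_row L}. det (principal_submatrix L Z))"

definition l_ensemble :: "real mat \<Rightarrow> nat set measure" where
  "l_ensemble L = point_measure (Pow {..<dim_row L}) (\<lambda>Y. ennreal (l_ensemble_mass L Y))"

text \<open>Independence of an indexed family: a repeated vector makes the family dependent, hence
  the injectivity requirement on top of the library's notion for sets.\<close>

definition lin_indpt_family :: "nat \<Rightarrow> (nat \<Rightarrow> real vec) \<Rightarrow> nat set \<Rightarrow> bool" where
  "lin_indpt_family m v Y \<longleftrightarrow>
     inj_on v Y \<and> \<not> module.lin_dep class_ring (module_vec TYPE(real) m) (v ` Y)"

definition parallelepiped :: "nat \<Rightarrow> (nat \<Rightarrow> real vec) \<Rightarrow> nat set \<Rightarrow> real vec set" where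
  "parallelepiped m v Y =
     {vec m (\<lambda>r. \<Sum>i\<in>Y. c i * v i $ r) | c. \<forall>i\<in>Y. 0 \<le> c i \<and> c i \<le> 1}"

text \<open>The \<open>k\<close>-dimensional volume of a subset \<open>S\<close> of \<open>\<real>\<^sup>m\<close> that lies in some \<open>k\<close>-dimensional
  linear subspace: pull \<open>S\<close> back along a linear isometry \<open>Q\<close> from \<open>\<real>\<^sup>k\<close> onto such a subspace
  (a matrix with orthonormal columns) and take \<open>k\<close>-dimensional Lebesgue measure.
  The description is meant for \<open>k \<le> m\<close> and measurable \<open>S\<close>; the value does not depend on \<open>Q\<close>,
  because Lebesgue measure is invariant under orthogonal maps and because a set lying in two
  different \<open>k\<close>-dimensional subspaces is null in both.\<close>

definition k_volume :: "nat \<Rightarrow> nat \<Rightarrow> real vec set \<Rightarrow> real" where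
  "k_volume m k S =
     (THE a. \<exists>Q \<in> carrier_mat m k.
        transpose_mat Q * Q = 1\<^sub>m k \<and>
        S \<subseteq> (\<lambda>x. Q *\<^sub>v x) ` carrier_vec k \<and>
        a = measure (Pi\<^sub>M {..<k} (\<lambda>_. lborel))
              {x \<in> PiE {..<k} (\<lambda>_. UNIV). Q *\<^sub>v vec k x \<in> S})"

definition vol :: "nat \<Rightarrow> (nat \<Rightarrow> real vec) \<Rightarrow> nat set \<Rightarrow> real" where
  "vol m v Y = k_volume m (card Y) (parallelepiped m v Y)"

end

(* The Leibniz formula expands det (L + I) into the sum of the principal minors of L, which
   normalizes the ensemble. For the volume, write V for the matrix of the selected columns. Any
   isometry Q whose range contains the columns satisfies V = Q (Q^T V), so that
   det (V^T V) = det (Q^T V)^2, while Q pulls the parallelepiped back to the image of the unit cube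
   under Q^T V, of measure |det (Q^T V)|. Hence the volume does not depend on Q and its square is the
   principal minor of the Gramian. Finally, det (V^T V) = 0 exactly if V has a nontrivial kernel,
   since x . V^T V x = |V x|^2, and observability is the case of all columns. *)
theory Submission
  imports Defs
begin

subsection \<open>Linear maps and Lebesgue measure on coordinate space\<close>

text \<open>\<open>k_volume\<close> is a definite description, so an isometry \<open>Q\<close> with
  all columns in its range must exist before anything can be computed, also when the columns are
  dependent and span fewer than \<open>k\<close> dimensions. Orthonormalization then fills the
  missing directions with vectors orthogonal to those found so far, and there is room for them only
  if \<open>k \<le> m\<close>. This is where N \<ge> 1 enters: O has \<open>N * n\<close> rows, and
  at most \<open>n\<close> columns are selected. Dependent columns also rule out a uniform change of
  variables: for singular \<open>W\<close>, the square matrix that represents the columns in the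
  coordinates of \<open>Q\<close>, the pulled-back set is null because it lies in a hyperplane. In
  the regular case the dimension is an arbitrary natural number and the space a product of copies of
  \<open>lborel\<close>, so the factor \<open>\<bar>det W\<bar>\<close> is traced back to
  one-dimensional integrals: an invertible matrix is a product of elementary ones, each of which
  alters a single coordinate.\<close>

abbreviation lebesgue_on_coords :: "nat \<Rightarrow> (nat \<Rightarrow> real) measure" where
  "lebesgue_on_coords k \<equiv> Pi\<^sub>M {..<k} (\<lambda>_. lborel)"

text \<open>Restriction makes the image extensional, so that it is again a point of the product
  space.\<close>

definition mat_apply :: "nat \<Rightarrow> real mat \<Rightarrow> (nat \<Rightarrow> real) \<Rightarrow> nat \<Rightarrow> real" where
  "mat_apply k M x = (\<lambda>i\<in>{..<k}. \<Sum>j<k. M $$ (i, j) * x j)"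

lemma measurable_mat_apply [measurable]:
  "mat_apply k M \<in> lebesgue_on_coords k \<rightarrow>\<^sub>M lebesgue_on_coords k"
  unfolding mat_apply_def by measurable

lemma mat_apply_extensional: "mat_apply k M x \<in> PiE {..<k} (\<lambda>_. UNIV)"
  by (simp add: mat_apply_def)

lemma mat_apply_mult:
  assumes "A \<in> carrier_mat k k" "B \<in> carrier_mat k k"
  shows "mat_apply k (A * B) x = mat_apply k A (mat_apply k B x)"
proof
  fix i
  show "mat_apply k (A * B) x i = mat_apply k A (mat_apply k B x) i"
  proof (cases "i < k")
    case True
    have "mat_apply k (A * B) x i = (\<Sum>j<k. \<Sum>l<k. A $$ (i, l) * B $$ (l, j) * x j)"
      using True assms by (simp add: mat_apply_def scalar_prod_def atLeast0LessThan sum_distrib_right)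
    also have "\<dots> = (\<Sum>l<k. A $$ (i, l) * (\<Sum>j<k. B $$ (l, j) * x j))"
      by (subst sum.swap) (simp add: sum_distrib_left mult.assoc)
    also have "\<dots> = mat_apply k A (mat_apply k B x) i"
      using True by (simp add: mat_apply_def)
    finally show ?thesis .
  qed (simp add: mat_apply_def)
qed

lemma mat_apply_one:
  assumes "x \<in> extensional {..<k}"
  shows "mat_apply k (1\<^sub>m k) x = x"
proof (rule ext)
  fix i
  have "(\<Sum>j<k. 1\<^sub>m k $$ (i, j) * x j) = (\<Sum>j<k. if j = i then x j else 0)" if "i < k"
    by (rule sum.cong) (use that in auto)
  then show "mat_apply k (1\<^sub>m k) x i = x i"
    using assms by (cases "i < k") (simp_all add: mat_apply_def extensional_arb[OF assms])
qed

text \<open>The change-of-variables formula, for integrands rather than sets: then it passes to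
  products of matrices by applying it to a composed integrand. Placing the determinant on the side
  of the transformed integral avoids division in \<open>ennreal\<close>. The formula fails for
  singular \<open>M\<close>, as a constant integrand shows.\<close>

definition scales_lebesgue :: "nat \<Rightarrow> real mat \<Rightarrow> bool" where
  "scales_lebesgue k M \<longleftrightarrow> (\<forall>f :: (nat \<Rightarrow> real) \<Rightarrow> ennreal. f \<in> borel_measurable (lebesgue_on_coords k) \<longrightarrow>
     ennreal \<bar>det M\<bar> * (\<integral>\<^sup>+x. f (mat_apply k M x) \<partial>lebesgue_on_coords k) = integral\<^sup>N (lebesgue_on_coords k) f)"

lemma scales_lebesgue_one: "scales_lebesgue k (1\<^sub>m k)"
  unfolding scales_lebesgue_def
  by (auto intro!: nn_integral_cong simp: mat_apply_one space_PiM PiE_def)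

lemma scales_lebesgue_mult:
  assumes "A \<in> carrier_mat k k" "B \<in> carrier_mat k k" "scales_lebesgue k A" "scales_lebesgue k B"
  shows "scales_lebesgue k (A * B)"
  unfolding scales_lebesgue_def
proof (intro allI impI)
  fix f :: "(nat \<Rightarrow> real) \<Rightarrow> ennreal" assume f [measurable]: "f \<in> borel_measurable (lebesgue_on_coords k)"
  let ?I = "\<lambda>f. integral\<^sup>N (lebesgue_on_coords k) f"
  have "\<bar>det (A * B)\<bar> * ?I (\<lambda>x. f (mat_apply k (A * B) x))
      = \<bar>det A\<bar> * (\<bar>det B\<bar> * ?I (\<lambda>x. f (mat_apply k A (mat_apply k B x))))"
    using assms(1,2) by (simp add: det_mult abs_mult ennreal_mult mat_apply_mult mult.assoc)
  also have "\<bar>det B\<bar> * ?I (\<lambda>x. f (mat_apply k A (mat_apply k B x))) = ?I (\<lambda>x. f (mat_apply k A x))"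
    using assms(4)[unfolded scales_lebesgue_def, rule_format, of "\<lambda>x. f (mat_apply k A x)"] by simp
  also have "\<bar>det A\<bar> * \<dots> = ?I f"
    using assms(3) unfolding scales_lebesgue_def by simp
  finally show "\<bar>det (A * B)\<bar> * ?I (\<lambda>x. f (mat_apply k (A * B) x)) = ?I f" .
qed

text \<open>The integral over coordinate \<open>i\<close> is taken first; the shift \<open>g x\<close> is constant along it.\<close>

lemma nn_integral_affine_coord:
  fixes f :: "(nat \<Rightarrow> real) \<Rightarrow> ennreal"
  assumes f [measurable]: "f \<in> borel_measurable (lebesgue_on_coords k)"
    and i: "i < k" and c: "c \<noteq> 0"
    and g [measurable]: "g \<in> borel_measurable (Pi\<^sub>M {..<k} (\<lambda>_. lborel))"
    and g_upd: "\<And>x y. g (x(i := y)) = g x"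
  shows "ennreal \<bar>c\<bar> * (\<integral>\<^sup>+x. f (x(i := g x + c * x i)) \<partial>lebesgue_on_coords k)
    = integral\<^sup>N (lebesgue_on_coords k) f"
proof -
  interpret product_sigma_finite "\<lambda>_::nat. lborel :: real measure" ..
  define J where "J = {..<k} - {i}"
  have J: "finite J" "i \<notin> J" "{..<k} = insert i J" using i by (auto simp: J_def)
  have f': "f \<in> borel_measurable (Pi\<^sub>M (insert i J) (\<lambda>_. lborel))" using f J(3) by simp
  have g': "g \<in> borel_measurable (Pi\<^sub>M (insert i J) (\<lambda>_. lborel))" using g J(3) by simp
  have upd: "(\<lambda>x. x(i := g x + c * x i)) \<in> Pi\<^sub>M (insert i J) (\<lambda>_. lborel) \<rightarrow>\<^sub>M Pi\<^sub>M (insert i J) (\<lambda>_. lborel)"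
    using g' by (intro measurable_fun_upd[where J="insert i J"]) auto
  have "(\<integral>\<^sup>+x. f (x(i := g x + c * x i)) \<partial>lebesgue_on_coords k) =
     (\<integral>\<^sup>+ x. (\<integral>\<^sup>+ y. f (x(i := g x + c * y)) \<partial>lborel) \<partial>(Pi\<^sub>M J (\<lambda>_. lborel)))"
    
    using product_nn_integral_insert[OF J(1,2) measurable_compose[OF upd f']]
    by (simp only: J(3) g_upd fun_upd_upd fun_upd_same)
  moreover have "integral\<^sup>N (lebesgue_on_coords k) f =
     (\<integral>\<^sup>+ x. (\<integral>\<^sup>+ y. f (x(i := y)) \<partial>lborel) \<partial>(Pi\<^sub>M J (\<lambda>_. lborel)))"
    using product_nn_integral_insert[OF J(1,2) f'] J(3) by simp
  moreover have "(\<integral>\<^sup>+ x. (\<integral>\<^sup>+ y. f (x(i := y)) \<partial>lborel) \<partial>(Pi\<^sub>M J (\<lambda>_. lborel))) =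
     (\<integral>\<^sup>+ x. ennreal \<bar>c\<bar> * (\<integral>\<^sup>+ y. f (x(i := g x + c * y)) \<partial>lborel) \<partial>(Pi\<^sub>M J (\<lambda>_. lborel)))"
  proof (rule nn_integral_cong)
    fix x assume x: "x \<in> space (Pi\<^sub>M J (\<lambda>_. lborel :: real measure))"
    have "(\<lambda>y. f (x(i := y))) \<in> borel_measurable lborel"
      using measurable_comp[OF measurable_component_update[OF x J(2)] f'] by (simp add: comp_def)
    then show "(\<integral>\<^sup>+ y. f (x(i := y)) \<partial>lborel) = ennreal \<bar>c\<bar> * (\<integral>\<^sup>+ y. f (x(i := g x + c * y)) \<partial>lborel)"
      by (intro nn_integral_real_affine[OF _ c]) simp
  qed
  moreover have "\<dots> = ennreal \<bar>c\<bar> * (\<integral>\<^sup>+ x. (\<integral>\<^sup>+ y. f (x(i := g x + c * y)) \<partial>lborel) \<partial>(Pi\<^sub>M J (\<lambda>_. lborel)))"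
  proof (rule nn_integral_cmult)
    \<comment> \<open>Joint measurability is inherited from the update map on the full product;
      afterwards \<open>g_upd\<close> removes the inner variable from the shift.\<close>
    have "(\<lambda>(x, y). f ((x(i := y))(i := g (x(i := y)) + c * (x(i := y)) i)))
       \<in> borel_measurable (Pi\<^sub>M J (\<lambda>_. lborel) \<Otimes>\<^sub>M lborel)"
      using measurable_compose[OF measurable_add_dim[of i J "\<lambda>_. lborel"] measurable_compose[OF upd f']]
      by (simp add: case_prod_unfold)
    then have "(\<lambda>(x, y). f (x(i := g x + c * y))) \<in> borel_measurable (Pi\<^sub>M J (\<lambda>_. lborel) \<Otimes>\<^sub>M lborel)"
      by (simp add: g_upd)
    then show "(\<lambda>x. \<integral>\<^sup>+ y. f (x(i := g x + c * y)) \<partial>lborel) \<in> borel_measurable (Pi\<^sub>M J (\<lambda>_. lborel))"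
      by measurable
  qed
  ultimately show ?thesis by (simp only:)
qed

section \<open>Elementary matrices\<close>

lemma mat_apply_addrow:
  assumes "i < k" "l < k" "i \<noteq> l" "x \<in> extensional {..<k}"
  shows "mat_apply k (addrow_mat k a i l) x = x(i := a * x l + 1 * x i)"
proof
  fix j
  show "mat_apply k (addrow_mat k a i l) x j = (x(i := a * x l + 1 * x i)) j"
  proof (cases "j < k")
    case True
    have "mat_apply k (addrow_mat k a i l) x j = (\<Sum>m<k. addrow_mat k a i l $$ (j, m) * x m)"
      using True by (simp only: mat_apply_def restrict_apply lessThan_iff if_True)
    also have "\<dots> = (\<Sum>m<k. (if m = l then (if j = i then a else 0) * x m else 0) + (if m = j then x m else 0))"
      by (rule sum.cong) (use True assms(1,2,3) in auto)
    also have "\<dots> = (if j = i then a else 0) * x l + x j"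
      using True assms(2) by (simp only: sum.distrib sum.delta finite_lessThan lessThan_iff if_True)
    finally show ?thesis by simp
  next
    case False
    with assms(1) extensional_arb[OF assms(4)] show ?thesis by (auto simp: mat_apply_def)
  qed
qed

lemma mat_apply_multrow:
  assumes "i < k" "x \<in> extensional {..<k}"
  shows "mat_apply k (multrow_mat k i a) x = x(i := 0 + a * x i)"
proof
  fix j
  show "mat_apply k (multrow_mat k i a) x j = (x(i := 0 + a * x i)) j"
  proof (cases "j < k")
    case True
    have "mat_apply k (multrow_mat k i a) x j = (\<Sum>m<k. multrow_mat k i a $$ (j, m) * x m)"
      using True by (simp only: mat_apply_def restrict_apply lessThan_iff if_True)
    also have "\<dots> = (\<Sum>m<k. (if m = j then (if j = i then a else 1) * x m else 0))"
      by (rule sum.cong) (use True assms(1) in auto)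
    also have "\<dots> = (if j = i then a else 1) * x j"
      using True by (simp only: sum.delta finite_lessThan lessThan_iff if_True)
    finally show ?thesis by simp
  next
    case False
    with assms(1) extensional_arb[OF assms(2)] show ?thesis by (auto simp: mat_apply_def)
  qed
qed

text \<open>Common form of both kinds of elementary matrix: coordinate \<open>i\<close> is scaled by
  \<open>c\<close> and shifted by an amount that depends only on the other coordinates. Row addition
  has \<open>c = 1\<close>, row scaling has \<open>g = 0\<close>; the terms \<open>1 * x i\<close>
  and \<open>0 + a * x i\<close> in the two preceding lemmas are spelled out to match this
  shape.\<close>

lemma scales_lebesgueI:
  assumes "i < k" "c \<noteq> 0" "\<bar>det M\<bar> = \<bar>c\<bar>"
    and "g \<in> borel_measurable (lebesgue_on_coords k)"
    and "\<And>x y. g (x(i := y)) = g x"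
    and "\<And>x. x \<in> extensional {..<k} \<Longrightarrow> mat_apply k M x = x(i := g x + c * x i)"
  shows "scales_lebesgue k M"
  unfolding scales_lebesgue_def
proof (intro allI impI)
  fix f :: "(nat \<Rightarrow> real) \<Rightarrow> ennreal" assume f: "f \<in> borel_measurable (lebesgue_on_coords k)"
  have "(\<integral>\<^sup>+x. f (mat_apply k M x) \<partial>lebesgue_on_coords k)
     = (\<integral>\<^sup>+x. f (x(i := g x + c * x i)) \<partial>lebesgue_on_coords k)"
  proof (rule nn_integral_cong)
    fix x assume "x \<in> space (lebesgue_on_coords k)"
    then have "x \<in> extensional {..<k}" by (simp add: space_PiM PiE_def)
    then show "f (mat_apply k M x) = f (x(i := g x + c * x i))" by (simp only: assms(6))
  qed
  then show "\<bar>det M\<bar> * (\<integral>\<^sup>+x. f (mat_apply k M x) \<partial>lebesgue_on_coords k)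
      = integral\<^sup>N (lebesgue_on_coords k) f"
    by (simp only: assms(3) nn_integral_affine_coord[OF f assms(1,2,4,5)])
qed

lemma scales_lebesgue_addrow:
  assumes "i < k" "l < k" "i \<noteq> l"
  shows "scales_lebesgue k (addrow_mat k a i l)"
proof (rule scales_lebesgueI)
  show "i < k" by fact
  show "(1::real) \<noteq> 0" by simp
  show "\<bar>det (addrow_mat k a i l)\<bar> = \<bar>1\<bar>" by (simp only: det_addrow_mat[OF assms(3)])
  show "mat_apply k (addrow_mat k a i l) x = x(i := a * x l + 1 * x i)"
    if "x \<in> extensional {..<k}" for x
    by (rule mat_apply_addrow[OF assms that])
  show "(\<lambda>x. a * x l) \<in> borel_measurable (lebesgue_on_coords k)"
    by (rule borel_measurable_times) (use assms(2) in simp_all)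
  show "a * (x(i := y)) l = a * x l" for x y using assms(3) by simp
qed

lemma scales_lebesgue_multrow:
  assumes "i < k" "a \<noteq> 0"
  shows "scales_lebesgue k (multrow_mat k i a)"
proof (rule scales_lebesgueI)
  show "i < k" by fact
  show "a \<noteq> 0" by fact
  show "\<bar>det (multrow_mat k i a)\<bar> = \<bar>a\<bar>" by (simp only: det_multrow_mat[OF assms(1)])
  show "mat_apply k (multrow_mat k i a) x = x(i := 0 + a * x i)"
    if "x \<in> extensional {..<k}" for x
    by (rule mat_apply_multrow[OF assms(1) that])
  show "(\<lambda>x. 0) \<in> borel_measurable (lebesgue_on_coords k)" by simp
  show "0 = (0::real)" for x y :: real ..
qed

section \<open>Elimination for invertible matrices\<close>

lemma det_0_if_no_pivot:
  fixes M :: "'a::field mat"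
  assumes M: "M \<in> carrier_mat k k" and j: "j < k"
    and clean: "\<And>r c. r < k \<Longrightarrow> c < j \<Longrightarrow> M $$ (r, c) = (if r = c then 1 else 0)"
    and zero: "\<And>r. j \<le> r \<Longrightarrow> r < k \<Longrightarrow> M $$ (r, j) = 0"
  shows "det M = 0"
proof -
  \<comment> \<open>The first \<open>j\<close> columns are unit vectors and column \<open>j\<close>
    vanishes from row \<open>j\<close> on, so column \<open>j\<close> is the combination of them
    whose coefficients are its own entries; \<open>v\<close> records this relation.\<close>
  define v where "v = vec k (\<lambda>i. if i < j then - M $$ (i, j) else if i = j then 1 else 0)"
  have "v $ j \<noteq> 0" using j by (simp add: v_def)
  then have "v \<noteq> 0\<^sub>v k" using j by auto
  moreover have "M *\<^sub>v v = 0\<^sub>v k"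
  proof (rule eq_vecI)
    fix r assume "r < dim_vec (0\<^sub>v k :: 'a vec)"
    then have r: "r < k" by simp
    have "(M *\<^sub>v v) $ r = (\<Sum>c<k. M $$ (r, c) * v $ c)"
      using M r by (simp add: scalar_prod_def atLeast0LessThan v_def)
    also have "\<dots> = (\<Sum>c<k. (if c = r then (if r < j then - M $$ (r, j) else 0) else 0)
        + (if c = j then M $$ (r, j) else 0))"
      by (rule sum.cong) (use r j in \<open>auto simp: v_def clean\<close>)
    also have "\<dots> = (if r < j then - M $$ (r, j) else 0) + M $$ (r, j)"
      using r j by (simp only: sum.distrib sum.delta finite_lessThan lessThan_iff if_True)
    also have "\<dots> = 0" using zero[of r] r by auto
    finally show "(M *\<^sub>v v) $ r = 0\<^sub>v k $ r" using r by simp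
  qed (use M in simp)
  moreover have "v \<in> carrier_vec k" by (simp add: v_def)
  ultimately show ?thesis
    using det_0_iff_vec_prod_zero_field[OF M] by blast
qed

text \<open>Gauss-Jordan elimination. Swaps are not needed: a vanishing pivot is made \<open>1\<close> by adding a
  multiple of a lower row.\<close>

lemma invertible_elementary_induct [consumes 2, case_names one addrow multrow]:
  fixes M :: "'a::field mat"
  assumes M: "M \<in> carrier_mat k k" and det: "det M \<noteq> 0"
    and one: "P (1\<^sub>m k)"
    and addrow: "\<And>M i l a. \<lbrakk>M \<in> carrier_mat k k; i < k; l < k; i \<noteq> l; P (addrow a i l M)\<rbrakk> \<Longrightarrow> P M"
    and multrow: "\<And>M i a. \<lbrakk>M \<in> carrier_mat k k; i < k; a \<noteq> 0; P (multrow i a M)\<rbrakk> \<Longrightarrow> P M"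
  shows "P M"
proof -
  define clean where
    "clean j M \<longleftrightarrow> (\<forall>r<k. \<forall>c<j. M $$ (r, c) = (if r = c then 1 else 0))" for j and M :: "'a mat"
  \<comment> \<open>Induction from \<open>j = k\<close>, where a clean matrix is the identity, down
    to \<open>j = 0\<close>, where cleanness says nothing. The step reduces a matrix with
    \<open>j\<close> clean columns to one with \<open>Suc j\<close>.\<close>
  have *: "P M" if "j \<le> k" "M \<in> carrier_mat k k" "det M \<noteq> 0" "clean j M" for j M
    using that
  proof (induction j arbitrary: M rule: inc_induct)
    case base
    then have "M = 1\<^sub>m k" by (intro eq_matI) (auto simp: clean_def)
    with one show ?case by simp
  next
    case (step j)
    \<comment> \<open>Inner induction of the same kind over the rows: column \<open>j\<close> has
      pivot \<open>1\<close> and is already cleared above row \<open>t\<close>. At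
      \<open>t = k\<close> the column is clean; the pivot row is passed over.\<close>
    have eliminate: "P M" if "t \<le> k" "M \<in> carrier_mat k k" "det M \<noteq> 0" "clean j M"
      "M $$ (j, j) = 1" "\<forall>r<t. r \<noteq> j \<longrightarrow> M $$ (r, j) = 0" for t M
      using that
    proof (induction t arbitrary: M rule: inc_induct)
      case base
      have "clean (Suc j) M"
        unfolding clean_def
      proof (intro allI impI)
        fix r c assume "r < k" "c < Suc j"
        with base show "M $$ (r, c) = (if r = c then 1 else 0)"
          by (cases "c = j") (auto simp: clean_def)
      qed
      with base show ?case by (intro step.IH)
    next
      case (step t)
      show ?case
      proof (cases "t = j")
        case True
        with step show ?thesis by (intro step.IH) (auto simp: less_Suc_eq)
      next
        case False
        \<comment> \<open>Row \<open>j\<close> is zero in the columns before \<open>j\<close>, so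
          subtracting a multiple of it keeps those columns clean.\<close>
        let ?M = "addrow (- M $$ (t, j)) t j M"
        have "P ?M"
          using step False \<open>j < k\<close>
          by (intro step.IH) (auto simp: less_Suc_eq clean_def det_addrow[of j k])
        then show ?thesis
          using step False \<open>j < k\<close> by (intro addrow[of M t j]) auto
      qed
    qed
    show ?case
    proof (cases "M $$ (j, j) = 0")
      case False
      let ?M = "multrow j (inverse (M $$ (j, j))) M"
      have "P ?M"
        using step False
        by (intro eliminate[of 0]) (auto simp: clean_def det_multrow[of j k])
      then show ?thesis
        using step False by (intro multrow[of M j]) auto
    next
      case True
      \<comment> \<open>Without such a row \<open>M\<close> would be singular. As
        \<open>j \<le> i\<close>, row \<open>i\<close> is zero in the columns before
        \<open>j\<close>, so adding a multiple of it preserves their cleanness.\<close>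
      obtain i where i: "j \<le> i" "i < k" "M $$ (i, j) \<noteq> 0"
        using det_0_if_no_pivot[of M k j] step by (auto simp: clean_def)
      with True have ij: "i \<noteq> j" by auto
      let ?M = "addrow (inverse (M $$ (i, j))) j i M"
      have "P ?M"
        using step i ij True
        by (intro eliminate[of 0]) (auto simp: clean_def det_addrow[of i k])
      then show ?thesis
        using step i ij by (intro addrow[of M j i]) auto
    qed
  qed
  show ?thesis by (rule *[of 0]) (use M det in \<open>auto simp: clean_def\<close>)
qed

lemma scales_lebesgue_invertible:
  assumes "M \<in> carrier_mat k k" "det M \<noteq> 0"
  shows "scales_lebesgue k M"
  using assms
proof (induction rule: invertible_elementary_induct)
  case one
  show ?case by (rule scales_lebesgue_one)
next
  case (addrow M i l a)
  \<comment> \<open>The induction hypothesis concerns the matrix after the row operation. Undoing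
    the operation is left multiplication by an elementary matrix of the same kind, and the product
    rule applies.\<close>
  have "M = (addrow_mat k (- a) i l * addrow_mat k a i l) * M"
    using addrow_mat_inv[of i k l "- a"] addrow.hyps by simp
  also have "\<dots> = addrow_mat k (- a) i l * addrow a i l M"
    using addrow.hyps by (subst assoc_mult_mat[of _ k k _ k _ k]) (auto simp: Gauss_Jordan_Elimination.addrow_mat[of M k k l])
  finally show ?case
    using addrow scales_lebesgue_addrow[of i k l "- a"]
    by (metis scales_lebesgue_mult addrow_mat_carrier addrow_carrier)
next
  case (multrow M i a)
  have "M = (multrow_mat k i (inverse a) * multrow_mat k i a) * M"
    using multrow_mat_inv[of i k "inverse a"] multrow.hyps by simp
  also have "\<dots> = multrow_mat k i (inverse a) * multrow i a M"
    using multrow.hyps by (subst assoc_mult_mat[of _ k k _ k _ k]) (auto simp: multrow_mat[of M k k])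
  finally show ?case
    using multrow scales_lebesgue_multrow[of i k "inverse a"]
    by (metis scales_lebesgue_mult multrow_mat_carrier multrow_carrier inverse_nonzero_iff_nonzero)
qed

section \<open>Null hyperplanes and the image of the unit cube\<close>

lemma null_sets_hyperplane:
  assumes i: "i < k" "w i \<noteq> 0"
  shows "{x \<in> space (lebesgue_on_coords k). (\<Sum>j<k. w j * x j) = 0} \<in> null_sets (lebesgue_on_coords k)"
    (is "?H \<in> _")
proof -
  interpret product_sigma_finite "\<lambda>_::nat. lborel :: real measure" ..
  define J where "J = {..<k} - {i}"
  have J: "finite J" "i \<notin> J" "{..<k} = insert i J" using i by (auto simp: J_def)
  have H: "?H \<in> sets (lebesgue_on_coords k)" by measurable
  have "emeasure (lebesgue_on_coords k) ?H = (\<integral>\<^sup>+x. indicator ?H x \<partial>lebesgue_on_coords k)"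
    using H by simp
  also have "\<dots> = (\<integral>\<^sup>+x. \<integral>\<^sup>+y. indicator ?H (x(i := y)) \<partial>lborel \<partial>Pi\<^sub>M J (\<lambda>_. lborel))"
    using product_nn_integral_insert[OF J(1,2), of "indicator ?H"] H unfolding J(3) by simp
  also have "\<dots> = (\<integral>\<^sup>+x. 0 \<partial>Pi\<^sub>M J (\<lambda>_. lborel :: real measure))"
  proof (rule nn_integral_cong)
    fix x :: "nat \<Rightarrow> real"
    \<comment> \<open>With the other coordinates fixed, the equation has a single solution in
      coordinate \<open>i\<close>, because \<open>w i \<noteq> 0\<close>; hence each inner integral
      is over a point.\<close>
    define y0 where "y0 = - (\<Sum>j\<in>J. w j * x j) / w i"
    have "y = y0" if "(\<Sum>j<k. w j * (x(i := y)) j) = 0" for y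
    proof -
      have "(\<Sum>j\<in>J. w j * (x(i := y)) j) = (\<Sum>j\<in>J. w j * x j)"
        using J(2) by (intro sum.cong) auto
      with that show ?thesis
        using i J(1,2) unfolding J(3) by (simp add: y0_def field_simps)
    qed
    then have "indicator ?H (x(i := y)) \<le> (indicator {y0} y :: ennreal)" for y
      by (auto simp: indicator_def)
    then have "(\<integral>\<^sup>+y. indicator ?H (x(i := y)) \<partial>lborel) \<le> (\<integral>\<^sup>+y. indicator {y0} y \<partial>lborel)"
      by (intro nn_integral_mono)
    then show "(\<integral>\<^sup>+y. indicator ?H (x(i := y)) \<partial>lborel) = 0" by simp
  qed
  finally show ?thesis using H by (auto simp: null_sets_def)
qed

lemma measure_parallelepiped:
  assumes W: "W \<in> carrier_mat k k"
  shows "measure (lebesgue_on_coords k)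
    {x \<in> PiE {..<k} (\<lambda>_. UNIV). \<exists>c. (\<forall>i<k. 0 \<le> c i \<and> c i \<le> 1) \<and> x = mat_apply k W c} = \<bar>det W\<bar>"
    (is "measure ?M ?S = _")
proof (cases "det W = 0")
  case True
  \<comment> \<open>A kernel vector of the transpose is orthogonal to the whole range of
    \<open>W\<close>, which therefore lies in a null hyperplane.\<close>
  then have "det (transpose_mat W) = 0" using W by (simp add: det_transpose)
  then obtain v where v: "v \<in> carrier_vec k" "v \<noteq> 0\<^sub>v k" "transpose_mat W *\<^sub>v v = 0\<^sub>v k"
    using det_0_iff_vec_prod_zero_field[of "transpose_mat W" k] W by auto
  then obtain i where i: "i < k" "v $ i \<noteq> 0" by (metis eq_vecI carrier_vecD index_zero_vec)
  have "(\<Sum>j<k. v $ j * mat_apply k W c j) = 0" for c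
  proof -
    have "(\<Sum>j<k. W $$ (j, l) * v $ j) = 0" if "l < k" for l
    proof -
      have "(transpose_mat W *\<^sub>v v) $ l = (\<Sum>j<k. W $$ (j, l) * v $ j)"
        using that v(1) W by (auto simp: scalar_prod_def atLeast0LessThan)
      with v(3) that show ?thesis by simp
    qed
    then have "(\<Sum>l<k. c l * (\<Sum>j<k. W $$ (j, l) * v $ j)) = 0" by simp
    moreover have "(\<Sum>l<k. c l * (\<Sum>j<k. W $$ (j, l) * v $ j)) = (\<Sum>j<k. v $ j * (\<Sum>l<k. W $$ (j, l) * c l))"
      unfolding sum_distrib_left by (subst sum.swap) (simp add: mult_ac)
    ultimately show ?thesis by (simp add: mat_apply_def)
  qed
  then have sub: "?S \<subseteq> {x \<in> space ?M. (\<Sum>j<k. v $ j * x j) = 0}" (is "_ \<subseteq> ?H")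
    by (auto simp: space_PiM)
  have null: "?H \<in> null_sets ?M"
    using null_sets_hyperplane[of i k "\<lambda>j. v $ j"] i by simp
  have "emeasure ?M ?S \<le> emeasure ?M ?H"
    by (rule emeasure_mono[OF sub]) (use null in auto)
  also have "\<dots> = 0" using null by auto
  finally show ?thesis using True by (simp add: measure_def)
next
  case False
  interpret product_sigma_finite "\<lambda>_::nat. lborel :: real measure" ..
  interpret finite_product_sigma_finite "\<lambda>_::nat. lborel :: real measure" "{..<k}" by standard simp
  let ?cube = "PiE {..<k} (\<lambda>_. {0..1::real})"
  \<comment> \<open>The scaling formula is used for the inverse: the indicator of the cube composed
    with \<open>B\<close> is the indicator of the parallelepiped, so that
    \<open>\<bar>det B\<bar>\<close> times its measure is the measure of the cube, which is
    1.\<close>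
  obtain B where B: "B \<in> carrier_mat k k" "W * B = 1\<^sub>m k" "B * W = 1\<^sub>m k"
    using det_non_zero_imp_unit[OF W False, of undefined]
    by (auto simp: Units_def ring_mat_def)
  have detB: "det W * det B = 1" using det_mult[OF W B(1)] B(2) by simp
  then have detB0: "det B \<noteq> 0" by auto
  have cube: "?cube \<in> sets ?M" by (intro sets_PiM_I_finite) auto
  have iff: "x \<in> ?S \<longleftrightarrow> mat_apply k B x \<in> ?cube" if x: "x \<in> extensional {..<k}" for x
  proof
    assume "x \<in> ?S"
    then obtain c where c: "\<forall>i<k. 0 \<le> c i \<and> c i \<le> 1" "x = mat_apply k W c" by blast
    \<comment> \<open>The values of \<open>c\<close> outside \<open>{..<k}\<close> are arbitrary.
      Cutting them off changes nothing in the image and makes the coefficient vector extensional, as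
      cancelling \<open>B * W\<close> requires.\<close>
    have "x = mat_apply k W (restrict c {..<k})"
      using c(2) by (simp add: mat_apply_def)
    then have "mat_apply k B x = restrict c {..<k}"
      by (simp add: mat_apply_mult[OF B(1) W, symmetric] B(3) mat_apply_one)
    then show "mat_apply k B x \<in> ?cube" using c(1) by auto
  next
    assume "mat_apply k B x \<in> ?cube"
    moreover have "x = mat_apply k W (mat_apply k B x)"
      using x by (simp add: mat_apply_mult[OF W B(1), symmetric] B(2) mat_apply_one)
    ultimately show "x \<in> ?S"
      using x by (auto simp: PiE_iff intro!: exI[of _ "mat_apply k B x"])
  qed
  have "?S = mat_apply k B -` ?cube \<inter> space ?M"
    using iff by (auto simp: space_PiM PiE_def)
  then have S: "?S \<in> sets ?M"
    using measurable_sets[OF measurable_mat_apply cube] by metis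
  have "(\<integral>\<^sup>+x. indicator ?cube (mat_apply k B x) \<partial>?M) = (\<integral>\<^sup>+x. indicator ?S x \<partial>?M)"
    using iff by (intro nn_integral_cong) (simp add: indicator_def space_PiM PiE_def)
  then have "ennreal \<bar>det B\<bar> * emeasure ?M ?S = emeasure ?M ?cube"
    using scales_lebesgue_invertible[OF B(1) detB0] cube S
    unfolding scales_lebesgue_def by (auto dest!: spec[of _ "indicator ?cube"])
  also have "\<dots> = 1" by (subst measure_times) simp_all
  finally have 1: "ennreal \<bar>det B\<bar> * emeasure ?M ?S = 1" .
  have "ennreal \<bar>det W\<bar> * (ennreal \<bar>det B\<bar> * emeasure ?M ?S) = emeasure ?M ?S"
    using detB by (simp add: mult.assoc[symmetric] ennreal_mult[symmetric] abs_mult[symmetric])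
  then have "emeasure ?M ?S = ennreal \<bar>det W\<bar>" using 1 by simp
  then show ?thesis by (simp add: measure_def)
qed

subsection \<open>Principal minors\<close>

lemma bij_betw_pick:
  assumes "finite Y"
  shows "bij_betw (pick Y) {..<card Y} Y"
proof -
  have "inj_on (pick Y) {..<card Y}"
    by (rule linorder_inj_onI') (metis lessThan_iff pick_mono_le less_irrefl)
  moreover have "pick Y ` {..<card Y} \<subseteq> Y"
    using pick_in_set_le by auto
  ultimately show ?thesis
    using assms by (simp add: bij_betw_def card_image card_subset_eq)
qed

lemma principal_submatrix_eq:
  assumes "M \<in> carrier_mat n n" "Y \<subseteq> {..<n}"
  shows "principal_submatrix M Y = mat (card Y) (card Y) (\<lambda>(i, j). M $$ (pick Y i, pick Y j))"
proof -
  have "{i. i < n \<and> i \<in> Y} = Y" using assms(2) by auto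
  then show ?thesis using assms(1) by (simp add: principal_submatrix_def submatrix_def)
qed

text \<open>The Leibniz formula indexed by permutations of \<open>Y\<close> itself, so that minors
  for different \<open>Y\<close> can be compared with permutations of \<open>{..<n}\<close>.
  Conjugation by the enumeration \<open>pick Y\<close> carries one index set to the other and
  preserves signs.\<close>

lemma det_principal_submatrix:
  assumes M: "M \<in> carrier_mat n n" and Y: "Y \<subseteq> {..<n}"
  shows "det (principal_submatrix M Y)
    = (\<Sum>p | p permutes Y. of_int (sign p) * (\<Prod>i\<in>Y. M $$ (i, p i)))"
proof -
  let ?k = "card Y" and ?f = "map_permutation {0..<card Y} (pick Y)"
  have fin: "finite Y" using Y finite_subset by auto
  then have bij: "bij_betw (pick Y) {0..<?k} Y"
    using bij_betw_pick by (simp add: atLeast0LessThan)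
  then have inj: "inj_on (pick Y) {0..<?k}" by (simp add: bij_betw_def)
  have bijp: "bij_betw ?f {p. p permutes {0..<?k}} {p. p permutes Y}"
    using bij_betw_permutations[OF bij] bij
    by (simp add: map_permutation_def[abs_def] restrict_id_def[abs_def] bij_betw_def comp_def)
  have "det (principal_submatrix M Y) = (\<Sum>p | p permutes {0..<?k}.
      of_int (sign p) * (\<Prod>i=0..<?k. M $$ (pick Y i, pick Y (p i))))"
    unfolding principal_submatrix_eq[OF M Y]
    by (subst det_def'[of _ ?k]) (auto intro!: sum.cong prod.cong simp: permutes_in_image)
  also have "\<dots> = (\<Sum>p | p permutes {0..<?k}.
      of_int (sign (?f p)) * (\<Prod>i\<in>Y. M $$ (i, ?f p i)))"
  proof (rule sum.cong)
    fix p assume "p \<in> {p. p permutes {0..<?k}}"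
    then have p: "p permutes {0..<?k}" by simp
    have "(\<Prod>i\<in>Y. M $$ (i, ?f p i)) = (\<Prod>i=0..<?k. M $$ (pick Y i, ?f p (pick Y i)))"
      by (rule prod.reindex_bij_betw[OF bij, symmetric])
    also have "\<dots> = (\<Prod>i=0..<?k. M $$ (pick Y i, pick Y (p i)))"
      by (rule prod.cong) (simp_all add: map_permutation_apply[OF inj])
    finally show "of_int (sign p) * (\<Prod>i=0..<?k. M $$ (pick Y i, pick Y (p i)))
        = of_int (sign (?f p)) * (\<Prod>i\<in>Y. M $$ (i, ?f p i))"
      using sign_map_permutation[OF inj p] by simp
  qed simp
  also have "\<dots> = (\<Sum>p | p permutes Y. of_int (sign p) * (\<Prod>i\<in>Y. M $$ (i, p i)))"
    by (rule sum.reindex_bij_betw[OF bijp])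
  finally show ?thesis .
qed

lemma det_add_one:
  assumes M: "M \<in> carrier_mat n n"
  shows "det (M + 1\<^sub>m n) = (\<Sum>Y\<in>Pow {..<n}. det (principal_submatrix M Y))"
proof -
  let ?N = "{..<n}"
  let ?s = "\<lambda>p :: nat \<Rightarrow> nat. of_int (sign p) :: real"
  \<comment> \<open>The permutations that survive in the term for \<open>Y\<close> fix everything
    outside \<open>Y\<close>; these are exactly the permutations of \<open>Y\<close>.\<close>
  have fix_iff: "p permutes ?N \<and> (\<forall>i\<in>?N - Y. i = p i) \<longleftrightarrow> p permutes Y" if "Y \<subseteq> ?N" for p Y
    using that permutes_superset[of p ?N Y] permutes_subset[of p Y ?N] permutes_not_in[of p Y]
    by (metis DiffD2)
  have "det (M + 1\<^sub>m n)
      = (\<Sum>p | p permutes ?N. ?s p * (\<Prod>i<n. M $$ (i, p i) + (if i = p i then 1 else 0)))"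
    unfolding det_def'[OF add_carrier_mat[OF one_carrier_mat]] atLeast0LessThan
  proof (rule sum.cong)
    fix p assume "p \<in> {p. p permutes ?N}"
    then have "(M + 1\<^sub>m n) $$ (i, p i) = M $$ (i, p i) + (if i = p i then 1 else 0)" if "i < n" for i
      using M that permutes_in_image[of p ?N i] by auto
    then show "?s p * (\<Prod>i<n. (M + 1\<^sub>m n) $$ (i, p i))
      = ?s p * (\<Prod>i<n. M $$ (i, p i) + (if i = p i then 1 else 0))" by simp
  qed simp
  \<comment> \<open>Multiplying out the product selects a set \<open>Y\<close> of rows that
    contribute an entry of \<open>M\<close>; the remaining rows contribute entries of the identity,
    whose product is 1 or 0.\<close>
  also have "\<dots> = (\<Sum>p | p permutes ?N. \<Sum>Y\<in>Pow ?N. ?s p * (\<Prod>i\<in>Y. M $$ (i, p i))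
      * (if \<forall>i\<in>?N - Y. i = p i then 1 else 0))"
  proof (rule sum.cong)
    fix p :: "nat \<Rightarrow> nat"
    have "(\<Prod>i\<in>A. if i = p i then 1 else 0) = (if \<forall>i\<in>A. i = p i then 1 else 0 :: real)"
      if "finite A" for A
      using that by (induction A) auto
    then show "?s p * (\<Prod>i<n. M $$ (i, p i) + (if i = p i then 1 else 0))
      = (\<Sum>Y\<in>Pow ?N. ?s p * (\<Prod>i\<in>Y. M $$ (i, p i)) * (if \<forall>i\<in>?N - Y. i = p i then 1 else 0))"
      by (simp add: prod_add sum_distrib_left mult.assoc)
  qed simp
  also have "\<dots> = (\<Sum>Y\<in>Pow ?N. \<Sum>p | p permutes ?N. ?s p * (\<Prod>i\<in>Y. M $$ (i, p i))
      * (if \<forall>i\<in>?N - Y. i = p i then 1 else 0))"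
    by (rule sum.swap)
  also have "\<dots> = (\<Sum>Y\<in>Pow ?N. det (principal_submatrix M Y))"
  proof (rule sum.cong)
    fix Y assume "Y \<in> Pow ?N"
    then have Y: "Y \<subseteq> ?N" by simp
    have "(\<Sum>p | p permutes ?N. ?s p * (\<Prod>i\<in>Y. M $$ (i, p i)) * (if \<forall>i\<in>?N - Y. i = p i then 1 else 0))
        = (\<Sum>p | p permutes ?N \<and> (\<forall>i\<in>?N - Y. i = p i). ?s p * (\<Prod>i\<in>Y. M $$ (i, p i)))"
      by (rule sum.mono_neutral_cong_right) (auto simp: finite_permutations)
    also have "\<dots> = det (principal_submatrix M Y)"
      unfolding fix_iff[OF Y] det_principal_submatrix[OF M Y] ..
    finally show "(\<Sum>p | p permutes ?N. ?s p * (\<Prod>i\<in>Y. M $$ (i, p i))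
        * (if \<forall>i\<in>?N - Y. i = p i then 1 else 0)) = det (principal_submatrix M Y)" .
  qed simp
  finally show ?thesis .
qed

subsection \<open>Gram determinants and volumes\<close>

lemma exists_orthogonal_nonzero:
  fixes q :: "nat \<Rightarrow> nat \<Rightarrow> real"
  assumes "k < m"
  shows "\<exists>z. (\<exists>r<m. z r \<noteq> 0) \<and> (\<forall>j<k. (\<Sum>r<m. q j r * z r) = 0)"
proof -
  \<comment> \<open>The \<open>k\<close> vectors become rows of a square matrix padded with zero
    rows. Row \<open>k\<close> is zero since \<open>k < m\<close>, so the matrix is singular and has
    a kernel vector, which is orthogonal to the given ones.\<close>
  define A where "A = mat m m (\<lambda>(i, r). if i < k then q i r else 0)"
  have A: "A \<in> carrier_mat m m" by (simp add: A_def)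
  have "transpose_mat A *\<^sub>v unit_vec m k = 0\<^sub>v m"
    using assms by (intro eq_vecI) (auto simp: A_def)
  moreover have "unit_vec m k \<noteq> (0\<^sub>v m :: real vec)" using assms by simp
  ultimately have "det (transpose_mat A) = 0"
    using det_0_iff_vec_prod_zero_field[of "transpose_mat A" m] A by (metis transpose_carrier_mat unit_vec_carrier)
  then obtain z where z: "z \<in> carrier_vec m" "z \<noteq> 0\<^sub>v m" "A *\<^sub>v z = 0\<^sub>v m"
    using det_0_iff_vec_prod_zero_field[OF A] det_transpose[OF A] by auto
  have "(\<Sum>r<m. q j r * z $ r) = 0" if "j < k" for j
  proof -
    have "(\<Sum>r<m. q j r * z $ r) = (A *\<^sub>v z) $ j"
      using that assms z(1) by (simp add: A_def scalar_prod_def atLeast0LessThan)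
    then show ?thesis using z(3) that assms by simp
  qed
  moreover have "\<exists>r<m. z $ r \<noteq> 0" using z(1,2) by (metis eq_vecI carrier_vecD index_zero_vec)
  ultimately show ?thesis by (intro exI[of _ "\<lambda>r. z $ r"]) simp
qed

text \<open>Gram-Schmidt for a family that may be dependent: always \<open>k\<close> orthonormal
  vectors result, and each \<open>v i\<close> equals its expansion in them.\<close>

lemma exists_orthonormal_spanning:
  fixes v :: "nat \<Rightarrow> nat \<Rightarrow> real"
  assumes "k \<le> m"
  shows "\<exists>q :: nat \<Rightarrow> nat \<Rightarrow> real.
    (\<forall>i<k. \<forall>j<k. (\<Sum>r<m. q i r * q j r) = (if i = j then 1 else 0)) \<and>
    (\<forall>i<k. \<forall>r<m. v i r = (\<Sum>j<k. (\<Sum>s<m. q j s * v i s) * q j r))"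
  using assms
proof (induction k)
  case (Suc k)
  let ?ip = "\<lambda>a b :: nat \<Rightarrow> real. \<Sum>r<m. a r * b r"
  have "k \<le> m" using Suc.prems by simp
  from Suc.IH[OF this] obtain q
    where q: "\<forall>i<k. \<forall>j<k. ?ip (q i) (q j) = (if i = j then 1 else 0)"
      "\<forall>i<k. \<forall>r<m. v i r = (\<Sum>j<k. ?ip (q j) (v i) * q j r)"
    by (elim exE conjE) (rule that)
  have orth: "?ip (q i) (q j) = (if i = j then 1 else 0)" if "i < k" "j < k" for i j
    by (rule q(1)[rule_format, OF that])
  have span: "v i r = (\<Sum>j<k. ?ip (q j) (v i) * q j r)" if "i < k" "r < m" for i r
    by (rule q(2)[rule_format, OF that])
  have ip_sum: "?ip a (\<lambda>r. \<Sum>j<k. c j * q j r) = (\<Sum>j<k. c j * ?ip a (q j))" for a c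
    by (simp add: sum_distrib_left, subst sum.swap) (simp add: mult_ac)
  define u where "u r = v k r - (\<Sum>j<k. ?ip (q j) (v k) * q j r)" for r
  have ip_u: "?ip a u = ?ip a (v k) - (\<Sum>j<k. ?ip (q j) (v k) * ?ip a (q j))" for a
    unfolding ip_sum[symmetric] by (simp add: u_def right_diff_distrib sum_subtractf)
  have u_orth: "?ip (q i) u = 0" if "i < k" for i
  proof -
    have "(\<Sum>j<k. ?ip (q j) (v k) * ?ip (q i) (q j)) = (\<Sum>j<k. if j = i then ?ip (q j) (v k) else 0)"
      using that by (intro sum.cong) (auto simp: orth)
    then show ?thesis using that by (simp add: ip_u)
  qed
  \<comment> \<open>The new direction is the residual \<open>u\<close> of \<open>v k\<close> if that
    is nonzero, and otherwise any nonzero vector orthogonal to the earlier ones.\<close>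
  obtain z where z: "\<exists>r<m. z r \<noteq> 0" "\<And>j. j < k \<Longrightarrow> ?ip (q j) z = 0"
    and zu: "(\<forall>r<m. u r = 0) \<or> z = u"
  proof (cases "\<exists>r<m. u r \<noteq> 0")
    case True
    then show ?thesis using that[of u] u_orth by blast
  next
    case False
    moreover obtain z where "\<exists>r<m. z r \<noteq> 0" "\<forall>j<k. ?ip (q j) z = 0"
      using exists_orthogonal_nonzero[of k m q] Suc.prems by auto
    ultimately show ?thesis using that[of z] by blast
  qed
  have pos: "?ip z z > 0"
  proof -
    obtain r where "r < m" "z r \<noteq> 0" using z(1) by blast
    then show ?thesis
      by (intro sum_pos2[of _ r]) (auto simp: zero_less_mult_iff linorder_neq_iff)
  qed
  define e where "e r = z r / sqrt (?ip z z)" for r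
  have ee: "?ip e e = 1"
    using pos by (simp add: e_def sum_divide_distrib[symmetric])
  have e_orth: "?ip (q j) e = 0" "?ip e (q j) = 0" if "j < k" for j
  proof -
    show "?ip (q j) e = 0"
      using z(2)[OF that] by (simp add: e_def sum_divide_distrib[symmetric])
    then show "?ip e (q j) = 0" by (simp add: mult.commute)
  qed
  have e_v: "?ip e (v k) = ?ip e u" by (simp add: ip_u e_orth)
  \<comment> \<open>The earlier vectors have no component along \<open>e\<close>, so their
    expansions survive the additional term.\<close>
  have e_vi: "?ip e (v i) = 0" if "i < k" for i
  proof -
    have "?ip e (v i) = ?ip e (\<lambda>r. \<Sum>j<k. ?ip (q j) (v i) * q j r)"
      by (rule sum.cong) (simp_all add: span[OF that, symmetric])
    also have "\<dots> = 0" by (simp only: ip_sum) (simp add: e_orth)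
    finally show ?thesis .
  qed
  \<comment> \<open>Both choices of \<open>z\<close> serve here: either \<open>e\<close> is the
    normalized residual, or the residual is zero and so are both sides.\<close>
  have e_u: "?ip e u * e r = u r" if "r < m" for r
    using zu
  proof
    assume "z = u"
    then have "?ip e u = sqrt (?ip z z)"
      using pos by (simp add: e_def sum_divide_distrib[symmetric] real_div_sqrt)
    then show ?thesis using \<open>z = u\<close> pos by (simp add: e_def)
  qed (use that in simp)
  define q' where "q' = q(k := e)"
  have "?ip (q' i) (q' j) = (if i = j then 1 else 0)" if "i < Suc k" "j < Suc k" for i j
    using that by (auto simp: q'_def less_Suc_eq orth e_orth ee)
  moreover have "v i r = (\<Sum>j<Suc k. ?ip (q' j) (v i) * q' j r)" if "i < Suc k" "r < m" for i r
  proof -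
    have "(\<Sum>j<Suc k. ?ip (q' j) (v i) * q' j r) = (\<Sum>j<k. ?ip (q j) (v i) * q j r) + ?ip e (v i) * e r"
      by (simp add: q'_def)
    then show ?thesis
      using that e_u[OF that(2)] by (cases "i = k") (auto simp: e_v e_vi u_def less_Suc_eq span[symmetric])
  qed
  ultimately show ?case by (intro exI[of _ q']) blast
qed simp

lemma exists_isometry_onto_column_space:
  fixes V :: "real mat"
  assumes V: "V \<in> carrier_mat m k" and "k \<le> m"
  obtains Q where "Q \<in> carrier_mat m k" "transpose_mat Q * Q = 1\<^sub>m k" "Q * (transpose_mat Q * V) = V"
proof -
  obtain q :: "nat \<Rightarrow> nat \<Rightarrow> real"
    where orth: "\<forall>i<k. \<forall>j<k. (\<Sum>r<m. q i r * q j r) = (if i = j then 1 else 0)"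
      and span: "\<forall>i<k. \<forall>r<m. V $$ (r, i) = (\<Sum>j<k. (\<Sum>s<m. q j s * V $$ (s, i)) * q j r)"
    using exists_orthonormal_spanning[OF \<open>k \<le> m\<close>, of "\<lambda>i r. V $$ (r, i)"] by blast
  define Q where "Q = mat m k (\<lambda>(r, i). q i r)"
  show ?thesis
  proof
    show Q: "Q \<in> carrier_mat m k" by (simp add: Q_def)
    show "transpose_mat Q * Q = 1\<^sub>m k"
    proof (rule eq_matI)
      fix i j assume "i < dim_row (1\<^sub>m k :: real mat)" "j < dim_col (1\<^sub>m k :: real mat)"
      then have ij: "i < k" "j < k" by auto
      then have "(transpose_mat Q * Q) $$ (i, j) = (\<Sum>r<m. q i r * q j r)"
        by (simp add: Q_def scalar_prod_def atLeast0LessThan)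
      also have "\<dots> = (if i = j then 1 else 0)" by (rule orth[rule_format, OF ij])
      finally show "(transpose_mat Q * Q) $$ (i, j) = 1\<^sub>m k $$ (i, j)" using ij by simp
    qed (simp_all add: Q_def)
    show "Q * (transpose_mat Q * V) = V"
    proof (rule eq_matI)
      fix r i assume "r < dim_row V" "i < dim_col V"
      then have ri: "r < m" "i < k" using V by auto
      then have "(Q * (transpose_mat Q * V)) $$ (r, i)
          = (\<Sum>j<k. q j r * (\<Sum>s<m. q j s * V $$ (s, i)))"
        using V by (simp add: Q_def scalar_prod_def atLeast0LessThan)
      also have "\<dots> = (\<Sum>j<k. (\<Sum>s<m. q j s * V $$ (s, i)) * q j r)"
        by (simp only: mult.commute)
      also have "\<dots> = V $$ (r, i)" by (rule span[rule_format, OF ri(2,1), symmetric])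
      finally show "(Q * (transpose_mat Q * V)) $$ (r, i) = V $$ (r, i)" .
    qed (use V in \<open>auto simp: Q_def\<close>)
  qed
qed

section \<open>The volume as a Gram determinant\<close>

lemma det_gram_isometry:
  fixes V :: "real mat"
  assumes V: "V \<in> carrier_mat m k" and Q: "Q \<in> carrier_mat m k"
    and QV: "Q * (transpose_mat Q * V) = V"
  shows "det (transpose_mat V * V) = (det (transpose_mat Q * V))\<^sup>2"
proof -
  let ?W = "transpose_mat Q * V"
  have W: "?W \<in> carrier_mat k k" using V Q by simp
  have "transpose_mat V * V = transpose_mat (Q * ?W) * V" by (simp only: QV)
  also have "\<dots> = transpose_mat ?W * transpose_mat Q * V"
    by (simp only: transpose_mult[OF Q W])
  also have "\<dots> = transpose_mat ?W * ?W"
    by (rule assoc_mult_mat) (use V Q W in auto)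
  finally show ?thesis
    using W by (simp add: det_mult[of _ k] det_transpose[of _ k] power2_eq_square)
qed

lemma vec_mat_apply:
  assumes "W \<in> carrier_mat k k"
  shows "vec k (mat_apply k W c) = W *\<^sub>v vec k c"
  using assms by (intro eq_vecI) (auto simp: mat_apply_def scalar_prod_def atLeast0LessThan)

lemma k_volume_mat_image_cube:
  fixes V :: "real mat"
  assumes V: "V \<in> carrier_mat m k" and "k \<le> m"
  shows "(k_volume m k {V *\<^sub>v vec k c | c. \<forall>i<k. 0 \<le> c i \<and> c i \<le> 1})\<^sup>2 = det (transpose_mat V * V)"
proof -
  let ?S = "{V *\<^sub>v vec k c | c. \<forall>i<k. 0 \<le> c i \<and> c i \<le> 1}"
  let ?pre = "\<lambda>Q. {x \<in> PiE {..<k} (\<lambda>_. UNIV). Q *\<^sub>v vec k x \<in> ?S}"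
  have meas: "measure (lebesgue_on_coords k) (?pre Q) = sqrt (det (transpose_mat V * V))"
    if Q: "Q \<in> carrier_mat m k" and QQ: "transpose_mat Q * Q = 1\<^sub>m k"
      and QV: "Q * (transpose_mat Q * V) = V" for Q
  proof -
    let ?W = "transpose_mat Q * V"
    have W: "?W \<in> carrier_mat k k" using V Q by simp
    have QQx: "transpose_mat Q *\<^sub>v (Q *\<^sub>v x) = x" if "x \<in> carrier_vec k" for x
      using assoc_mult_mat_vec[of "transpose_mat Q" k m Q k x] Q that QQ by simp
    have QWc: "Q *\<^sub>v (?W *\<^sub>v c) = V *\<^sub>v c" if "c \<in> carrier_vec k" for c
      using assoc_mult_mat_vec[OF Q W that] QV by simp
    have "Q *\<^sub>v vec k x = V *\<^sub>v vec k c \<longleftrightarrow> x = mat_apply k ?W c"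
      if x: "x \<in> PiE {..<k} (\<lambda>_. UNIV)" for x c
    proof
      assume "Q *\<^sub>v vec k x = V *\<^sub>v vec k c"
      then have "Q *\<^sub>v vec k x = Q *\<^sub>v (?W *\<^sub>v vec k c)" by (simp add: QWc)
      then have "vec k x = ?W *\<^sub>v vec k c"
        using QQx[of "vec k x"] QQx[of "?W *\<^sub>v vec k c"] mult_mat_vec_carrier[OF W, of "vec k c"]
        by (metis vec_carrier)
      then have "vec k x = vec k (mat_apply k ?W c)" by (simp only: vec_mat_apply[OF W])
      then have "x i = mat_apply k ?W c i" if "i < k" for i
        using that by (metis index_vec)
      then show "x = mat_apply k ?W c"
        using x mat_apply_extensional by (intro PiE_ext[of _ "{..<k}" "\<lambda>_. UNIV"]) auto
    next
      assume "x = mat_apply k ?W c"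
      then show "Q *\<^sub>v vec k x = V *\<^sub>v vec k c"
        by (simp only: vec_mat_apply[OF W]) (simp add: QWc)
    qed
    then have "?pre Q = {x \<in> PiE {..<k} (\<lambda>_. UNIV).
        \<exists>c. (\<forall>i<k. 0 \<le> c i \<and> c i \<le> 1) \<and> x = mat_apply k ?W c}"
      by (intro Collect_cong conj_cong refl) (simp only: mem_Collect_eq, metis (no_types))
    then have "measure (lebesgue_on_coords k) (?pre Q) = \<bar>det ?W\<bar>"
      by (simp only: measure_parallelepiped[OF W])
    then show ?thesis by (simp add: det_gram_isometry[OF V Q QV])
  qed
  \<comment> \<open>Each column of \<open>V\<close> is itself a point of the parallelepiped, with
    one coefficient 1 and the others 0. So it lies in the range of \<open>Q\<close>, on which
    \<open>Q * transpose_mat Q\<close> acts as the identity.\<close>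
  have QV: "Q * (transpose_mat Q * V) = V"
    if Q: "Q \<in> carrier_mat m k" and QQ: "transpose_mat Q * Q = 1\<^sub>m k"
      and S: "?S \<subseteq> (\<lambda>x. Q *\<^sub>v x) ` carrier_vec k" for Q
  proof (rule mat_col_eqI)
    fix i assume "i < dim_col V"
    then have i: "i < k" using V by simp
    have "V *\<^sub>v vec k (\<lambda>j. if j = i then 1 else 0) \<in> ?S"
      by (intro CollectI exI[of _ "\<lambda>j. if j = i then 1 else 0"]) simp
    moreover have "V *\<^sub>v vec k (\<lambda>j. if j = i then 1 else 0) = col V i"
    proof (rule eq_vecI)
      fix r assume "r < dim_vec (col V i)"
      then have r: "r < m" using V by simp
      then have "(V *\<^sub>v vec k (\<lambda>j. if j = i then 1 else 0)) $ r = (\<Sum>j<k. V $$ (r, j) * (if j = i then 1 else 0))"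
        using V by (simp add: scalar_prod_def atLeast0LessThan)
      also have "\<dots> = (\<Sum>j<k. if j = i then V $$ (r, j) else 0)"
        by (rule sum.cong) auto
      finally show "(V *\<^sub>v vec k (\<lambda>j. if j = i then 1 else 0)) $ r = col V i $ r"
        using V i r by simp
    qed (use V in simp)
    ultimately obtain x where x: "x \<in> carrier_vec k" "col V i = Q *\<^sub>v x" using S by auto
    have "col (Q * (transpose_mat Q * V)) i = Q *\<^sub>v (transpose_mat Q *\<^sub>v (Q *\<^sub>v x))"
      using Q V i x(2)
      by (subst col_mult2[OF Q _ i], simp, subst col_mult2[of "transpose_mat Q" k m V k]) simp_all
    also have "transpose_mat Q *\<^sub>v (Q *\<^sub>v x) = x"
      using assoc_mult_mat_vec[of "transpose_mat Q" k m Q k x] Q x(1) QQ by simp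
    finally show "col (Q * (transpose_mat Q * V)) i = col V i" using x(2) by simp
  qed (use Q V in auto)
  obtain Q where Q: "Q \<in> carrier_mat m k" "transpose_mat Q * Q = 1\<^sub>m k" "Q * (transpose_mat Q * V) = V"
    using exists_isometry_onto_column_space[OF V \<open>k \<le> m\<close>] .
  have sub: "?S \<subseteq> (\<lambda>x. Q *\<^sub>v x) ` carrier_vec k"
  proof
    fix y assume "y \<in> ?S"
    then obtain c where "y = V *\<^sub>v vec k c" by blast
    also have "\<dots> = Q *\<^sub>v ((transpose_mat Q * V) *\<^sub>v vec k c)"
      using Q V by (subst assoc_mult_mat_vec[symmetric, of _ m k _ k]) auto
    finally show "y \<in> (\<lambda>x. Q *\<^sub>v x) ` carrier_vec k" using Q V by auto
  qed
  \<comment> \<open>Existence comes from the orthonormalized columns, uniqueness from the fact that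
    every admissible \<open>Q\<close> satisfies \<open>QV\<close> and hence yields the value in
    \<open>meas\<close>.\<close>
  have "k_volume m k ?S = sqrt (det (transpose_mat V * V))"
    unfolding k_volume_def
  proof (rule the_equality)
    show "\<exists>Q\<in>carrier_mat m k. transpose_mat Q * Q = 1\<^sub>m k \<and> ?S \<subseteq> (\<lambda>x. Q *\<^sub>v x) ` carrier_vec k \<and>
        sqrt (det (transpose_mat V * V)) = measure (lebesgue_on_coords k) (?pre Q)"
      using Q sub meas by (intro bexI[of _ Q]) auto
  next
    fix a
    assume "\<exists>Q\<in>carrier_mat m k. transpose_mat Q * Q = 1\<^sub>m k \<and> ?S \<subseteq> (\<lambda>x. Q *\<^sub>v x) ` carrier_vec k \<and>
        a = measure (lebesgue_on_coords k) (?pre Q)"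
    then show "a = sqrt (det (transpose_mat V * V))" using QV meas by blast
  qed
  moreover have "det (transpose_mat V * V) \<ge> 0"
    by (simp add: det_gram_isometry[OF V Q(1,3)])
  ultimately show ?thesis by simp
qed

section \<open>Kernel and positivity of Gram matrices, selected columns\<close>

lemma scalar_prod_self_nonneg: "0 \<le> v \<bullet> (v :: real vec)"
  by (simp add: scalar_prod_def sum_nonneg)

lemma scalar_prod_self_eq_0:
  assumes "v \<in> carrier_vec m" "v \<bullet> (v :: real vec) = 0"
  shows "v = 0\<^sub>v m"
proof (rule eq_vecI)
  fix i assume "i < dim_vec (0\<^sub>v m :: real vec)"
  moreover have "\<forall>i\<in>{0..<m}. v $ i * v $ i = 0"
    using assms by (subst sum_nonneg_eq_0_iff[symmetric]) (auto simp: scalar_prod_def)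
  ultimately show "v $ i = 0\<^sub>v m $ i" by simp
qed (use assms in simp)

lemma gram_det_0_iff:
  fixes V :: "real mat"
  assumes V: "V \<in> carrier_mat m k"
  shows "det (transpose_mat V * V) = 0 \<longleftrightarrow> (\<exists>x. x \<in> carrier_vec k \<and> x \<noteq> 0\<^sub>v k \<and> V *\<^sub>v x = 0\<^sub>v m)"
proof -
  have "(transpose_mat V * V) *\<^sub>v x = 0\<^sub>v k \<longleftrightarrow> V *\<^sub>v x = 0\<^sub>v m" if x: "x \<in> carrier_vec k" for x
  proof
    have assoc: "(transpose_mat V * V) *\<^sub>v x = transpose_mat V *\<^sub>v (V *\<^sub>v x)"
      by (rule assoc_mult_mat_vec) (use V x in auto)
    show "V *\<^sub>v x = 0\<^sub>v m" if "(transpose_mat V * V) *\<^sub>v x = 0\<^sub>v k"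
    proof -
      have "(V *\<^sub>v x) \<bullet> (V *\<^sub>v x) = (transpose_mat V *\<^sub>v (V *\<^sub>v x)) \<bullet> x"
        by (rule transpose_vec_mult_scalar[OF V x mult_mat_vec_carrier[OF V x], symmetric])
      also have "\<dots> = 0" using that x by (simp add: assoc[symmetric])
      finally show ?thesis by (rule scalar_prod_self_eq_0[OF mult_mat_vec_carrier[OF V x]])
    qed
    show "(transpose_mat V * V) *\<^sub>v x = 0\<^sub>v k" if "V *\<^sub>v x = 0\<^sub>v m"
      using V that by (simp only: assoc) auto
  qed
  then show ?thesis
    using det_0_iff_vec_prod_zero_field[of "transpose_mat V * V" k] V by auto
qed

lemma pos_semidef_gram:
  fixes V :: "real mat"
  assumes V: "V \<in> carrier_mat m k"
  shows "pos_semidef (transpose_mat V * V)"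
  unfolding pos_semidef_def
proof (intro conjI ballI)
  show "square_mat (transpose_mat V * V)" using V by simp
  show "transpose_mat (transpose_mat V * V) = transpose_mat V * V"
    using V by (subst transpose_mult[of _ k m]) auto
  fix x :: "real vec" assume "x \<in> carrier_vec (dim_row (transpose_mat V * V))"
  then have x: "x \<in> carrier_vec k" using V by simp
  have "x \<bullet> ((transpose_mat V * V) *\<^sub>v x) = (transpose_mat V *\<^sub>v (V *\<^sub>v x)) \<bullet> x"
    using V x by (subst assoc_mult_mat_vec[of _ k m _ k]) (auto intro!: comm_scalar_prod[of _ k])
  also have "\<dots> = (V *\<^sub>v x) \<bullet> (V *\<^sub>v x)"
    by (rule transpose_vec_mult_scalar[OF V x mult_mat_vec_carrier[OF V x]])
  finally show "0 \<le> x \<bullet> ((transpose_mat V * V) *\<^sub>v x)" by (simp add: scalar_prod_self_nonneg)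
qed

text \<open>The enumeration \<open>pick\<close> is also the one behind \<open>submatrix\<close>, so
  the Gram matrix of the selection is the principal submatrix with no reordering.\<close>

definition col_submatrix :: "'a mat \<Rightarrow> nat set \<Rightarrow> 'a mat" where
  "col_submatrix V Y = mat (dim_row V) (card Y) (\<lambda>(r, i). V $$ (r, pick Y i))"

lemma col_submatrix_carrier: "V \<in> carrier_mat m n \<Longrightarrow> col_submatrix V Y \<in> carrier_mat m (card Y)"
  by (simp add: col_submatrix_def)

lemma pick_mem: "finite Y \<Longrightarrow> i < card Y \<Longrightarrow> pick Y i \<in> Y"
  using bij_betw_pick[of Y] by (auto simp: bij_betw_def)

lemma cols_col_submatrix:
  assumes "V \<in> carrier_mat m n" "Y \<subseteq> {..<n}"
  shows "cols (col_submatrix V Y) = map (\<lambda>i. col V (pick Y i)) [0..<card Y]"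
proof (rule nth_equalityI)
  fix i assume "i < length (cols (col_submatrix V Y))"
  then have i: "i < card Y" by (simp add: col_submatrix_def)
  then have "pick Y i < n" using assms(2) pick_mem[of Y i] finite_subset by auto
  with i assms(1) show "cols (col_submatrix V Y) ! i = map (\<lambda>i. col V (pick Y i)) [0..<card Y] ! i"
    by (auto simp: col_submatrix_def intro!: eq_vecI)
qed (simp add: col_submatrix_def)

lemma principal_submatrix_gram:
  assumes V: "V \<in> carrier_mat m n" and Y: "Y \<subseteq> {..<n}"
  shows "principal_submatrix (transpose_mat V * V) Y = transpose_mat (col_submatrix V Y) * col_submatrix V Y"
proof -
  have W: "transpose_mat V * V \<in> carrier_mat n n" using V by simp
  have lt: "pick Y i < n" if "i < card Y" for i
    using that Y pick_mem[of Y i] finite_subset by auto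
  show ?thesis
    unfolding principal_submatrix_eq[OF W Y]
  proof (rule eq_matI)
    fix i j
    assume "i < dim_row (transpose_mat (col_submatrix V Y) * col_submatrix V Y)"
      "j < dim_col (transpose_mat (col_submatrix V Y) * col_submatrix V Y)"
    then have "i < card Y" "j < card Y" by (auto simp: col_submatrix_def)
    with lt V show "mat (card Y) (card Y) (\<lambda>(i, j). (transpose_mat V * V) $$ (pick Y i, pick Y j)) $$ (i, j)
        = (transpose_mat (col_submatrix V Y) * col_submatrix V Y) $$ (i, j)"
      by (simp add: col_submatrix_def scalar_prod_def)
  qed (simp_all add: col_submatrix_def)
qed

lemma vol_columns:
  fixes V :: "real mat"
  assumes V: "V \<in> carrier_mat m n" and Y: "Y \<subseteq> {..<n}" and "n \<le> m"
  shows "(vol m (col V) Y)\<^sup>2 = det (principal_submatrix (transpose_mat V * V) Y)"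
proof -
  let ?k = "card Y" and ?V = "col_submatrix V Y"
  have fin: "finite Y" using Y finite_subset by auto
  have V': "?V \<in> carrier_mat m ?k" by (rule col_submatrix_carrier[OF V])
  have bij: "bij_betw (pick Y) {..<?k} Y" by (rule bij_betw_pick[OF fin])
  have eq: "vec m (\<lambda>r. \<Sum>i\<in>Y. c i * col V i $ r) = ?V *\<^sub>v vec ?k (\<lambda>i. c (pick Y i))" for c
  proof (rule eq_vecI)
    fix r assume "r < dim_vec (?V *\<^sub>v vec ?k (\<lambda>i. c (pick Y i)))"
    then have r: "r < m" using V' by simp
    have "(\<Sum>i\<in>Y. c i * col V i $ r) = (\<Sum>i<?k. c (pick Y i) * col V (pick Y i) $ r)"
      by (rule sum.reindex_bij_betw[OF bij, symmetric])
    also have "\<dots> = (\<Sum>i<?k. ?V $$ (r, i) * c (pick Y i))"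
    proof (rule sum.cong)
      fix i assume "i \<in> {..<?k}"
      then have "pick Y i < n" "i < ?k" using pick_mem[OF fin, of i] Y by auto
      then show "c (pick Y i) * col V (pick Y i) $ r = ?V $$ (r, i) * c (pick Y i)"
        using V r by (simp add: col_submatrix_def)
    qed simp
    also have "\<dots> = (?V *\<^sub>v vec ?k (\<lambda>i. c (pick Y i))) $ r"
      using V' r by (simp add: scalar_prod_def atLeast0LessThan)
    finally show "vec m (\<lambda>r. \<Sum>i\<in>Y. c i * col V i $ r) $ r = (?V *\<^sub>v vec ?k (\<lambda>i. c (pick Y i))) $ r"
      using r by simp
  qed (use V' in simp)
  have "parallelepiped m (col V) Y = {?V *\<^sub>v vec ?k c | c. \<forall>i<?k. 0 \<le> c i \<and> c i \<le> 1}"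
  proof
    show "parallelepiped m (col V) Y \<subseteq> {?V *\<^sub>v vec ?k c | c. \<forall>i<?k. 0 \<le> c i \<and> c i \<le> 1}"
      unfolding parallelepiped_def eq using pick_mem[OF fin] by blast
    show "{?V *\<^sub>v vec ?k c | c. \<forall>i<?k. 0 \<le> c i \<and> c i \<le> 1} \<subseteq> parallelepiped m (col V) Y"
    proof
      fix y assume "y \<in> {?V *\<^sub>v vec ?k c | c. \<forall>i<?k. 0 \<le> c i \<and> c i \<le> 1}"
      then obtain c where c: "\<forall>i<?k. 0 \<le> c i \<and> c i \<le> 1" and y: "y = ?V *\<^sub>v vec ?k c" by blast
      \<comment> \<open>Coefficients indexed by position are carried back to coefficients indexed by
        \<open>Y\<close> along the inverse of the enumeration.\<close>
      define d where "d = c \<circ> inv_into {..<?k} (pick Y)"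
      have "vec ?k (\<lambda>i. d (pick Y i)) = vec ?k c"
        by (rule eq_vecI) (use bij in \<open>auto simp: d_def bij_betw_def\<close>)
      moreover have "\<forall>i\<in>Y. 0 \<le> d i \<and> d i \<le> 1"
      proof
        fix i assume "i \<in> Y"
        then have "inv_into {..<?k} (pick Y) i < ?k"
          using bij_betw_inv_into[OF bij] by (auto simp: bij_betw_def)
        then show "0 \<le> d i \<and> d i \<le> 1" using c by (simp add: d_def)
      qed
      ultimately show "y \<in> parallelepiped m (col V) Y"
        unfolding parallelepiped_def eq y by (intro CollectI exI[of _ d]) simp
    qed
  qed
  moreover have "card Y \<le> m" using card_mono[OF _ Y] \<open>n \<le> m\<close> by simp
  ultimately show ?thesis
    using k_volume_mat_image_cube[OF V'] principal_submatrix_gram[OF V Y] by (simp add: vol_def)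
qed

section \<open>Linear independence and rank\<close>

lemma lin_indpt_columns_iff:
  fixes V :: "real mat"
  assumes V: "V \<in> carrier_mat m n" and Y: "Y \<subseteq> {..<n}"
  shows "lin_indpt_family m (col V) Y \<longleftrightarrow> det (principal_submatrix (transpose_mat V * V) Y) \<noteq> 0"
proof -
  interpret vec_space "TYPE(real)" m .
  let ?k = "card Y" and ?V = "col_submatrix V Y"
  have V': "?V \<in> carrier_mat m ?k" by (rule col_submatrix_carrier[OF V])
  have fin: "finite Y" using Y finite_subset by auto
  have bij: "bij_betw (pick Y) {..<?k} Y" by (rule bij_betw_pick[OF fin])
  have cols: "cols ?V = map (\<lambda>i. col V (pick Y i)) [0..<?k]"
    by (rule cols_col_submatrix[OF V Y])
  have set_cols: "set (cols ?V) = col V ` Y"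
    using bij by (auto simp: cols bij_betw_def atLeast0LessThan image_image[symmetric])
  have dist: "distinct (cols ?V) \<longleftrightarrow> inj_on (col V) Y"
    using bij comp_inj_on_iff[of "pick Y" "{..<?k}" "col V"]
    by (simp add: cols distinct_map bij_betw_def atLeast0LessThan comp_def)
  show ?thesis
  proof (cases "inj_on (col V) Y")
    case True
    then have "lin_indpt (col V ` Y) \<longleftrightarrow> \<not> (\<exists>x. x \<in> carrier_vec ?k \<and> x \<noteq> 0\<^sub>v ?k \<and> ?V *\<^sub>v x = 0\<^sub>v m)"
      using lin_depI[OF V'] lin_depE[OF V'] dist set_cols by metis
    then show ?thesis
      using True gram_det_0_iff[OF V'] principal_submatrix_gram[OF V Y]
      by (simp add: lin_indpt_family_def)
  next
    case False
    moreover have len: "length (cols ?V) = ?k" using V' by simp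
    ultimately obtain i j where ij: "i < ?k" "j < ?k" "i \<noteq> j" "cols ?V ! i = cols ?V ! j"
      using dist by (auto simp: distinct_conv_nth)
    then have col_eq: "col ?V i = col ?V j" using V' by simp
    \<comment> \<open>The set of columns may be independent although a column is repeated, so this
      case needs its own kernel vector: the difference of the two unit vectors belonging to equal
      columns.\<close>
    let ?x = "unit_vec ?k i - unit_vec ?k j :: real vec"
    have "?x $ i \<noteq> 0" using ij by simp
    then have "?x \<noteq> 0\<^sub>v ?k" using ij(1) by (metis index_zero_vec(1))
    moreover have "?V *\<^sub>v ?x = 0\<^sub>v m"
    proof (rule eq_vecI)
      fix r assume "r < dim_vec (0\<^sub>v m :: real vec)"
      then have r: "r < m" by simp
      have "(?V *\<^sub>v ?x) $ r = col ?V i $ r - col ?V j $ r"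
        using V' ij(1-3) r by (simp add: scalar_prod_minus_distrib[of _ ?k])
      then show "(?V *\<^sub>v ?x) $ r = 0\<^sub>v m $ r" using r by (simp add: col_eq)
    qed (use V' in simp)
    moreover have "?x \<in> carrier_vec ?k" by simp
    ultimately have "det (transpose_mat ?V * ?V) = 0"
      using gram_det_0_iff[OF V'] by blast
    with False show ?thesis
      using principal_submatrix_gram[OF V Y] by (simp add: lin_indpt_family_def)
  qed
qed

lemma rank_eq_dim_col_iff:
  fixes V :: "real mat"
  assumes V: "V \<in> carrier_mat m n"
  shows "vec_space.rank m V = n \<longleftrightarrow> lin_indpt_family m (col V) {..<n}"
proof -
  interpret vec_space "TYPE(real)" m .
  have cols: "cols V = map (col V) [0..<n]" using V by (simp add: cols_def)
  have set_cols: "set (cols V) = col V ` {..<n}" by (simp add: cols atLeast0LessThan)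
  have dist: "distinct (cols V) \<longleftrightarrow> inj_on (col V) {..<n}"
    by (simp add: cols distinct_map atLeast0LessThan)
  show ?thesis
  proof
    assume rank: "rank V = n"
    \<comment> \<open>The rank is the size of a maximal independent set of columns. Rank
      \<open>n\<close> thus forces \<open>n\<close> distinct columns, which supplies the injectivity
      in \<open>lin_indpt_family\<close>.\<close>
    have "rank V \<le> card (set (cols V))"
    proof -
      have "lin_indpt {}" by (rule subset_li_is_li[of "{}"]) (auto simp: lin_dep_def)
      then obtain S where "maximal S (\<lambda>T. T \<subseteq> set (cols V) \<and> lin_indpt T)"
        using maximal_exists_superset[of "set (cols V)" "\<lambda>T. T \<subseteq> set (cols V) \<and> lin_indpt T" "{}"] by auto
      then show ?thesis
        using rank_card_indpt[OF V] by (simp add: card_mono maximal_def)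
    qed
    then have "distinct (cols V)"
      using rank card_length[of "cols V"] V by (intro card_distinct) simp
    then show "lin_indpt_family m (col V) {..<n}"
      using full_rank_lin_indpt[OF V rank] dist set_cols by (simp add: lin_indpt_family_def)
  next
    assume "lin_indpt_family m (col V) {..<n}"
    then show "rank V = n"
      using lin_indpt_full_rank[OF V] dist set_cols by (simp add: lin_indpt_family_def)
  qed
qed

lemma lin_indpt_family_subset:
  assumes "lin_indpt_family m v Y" "Z \<subseteq> Y"
  shows "lin_indpt_family m v Z"
proof -
  interpret vec_space "TYPE(real)" m .
  show ?thesis
    using assms subset_li_is_li[of "v ` Y" "v ` Z"] inj_on_subset
    unfolding lin_indpt_family_def by blast
qed

theorem theorem1:
  fixes n N :: nat and A C obs W L :: "real mat" and col_obs :: "nat \<Rightarrow> real vec"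
  assumes "A \<in> carrier_mat n n"
    and "C = 1\<^sub>m n"
    and "N \<ge> 1"
    and "obs = obs_matrix N A C"
    and "W = obs_gramian N A C"
    and "L = W"
    and "col_obs = (\<lambda>i. col obs i)"
  shows "pos_semidef L
    \<and> ((\<forall>Y. Y \<subseteq> {..<n} \<longrightarrow> 0 \<le> l_ensemble_mass L Y)
        \<and> (\<Sum>Y \<in> Pow {..<n}. l_ensemble_mass L Y) = 1
        \<and> prob_space (l_ensemble L))
    \<and> (\<forall>Y. Y \<subseteq> {..<n} \<longrightarrow>
          l_ensemble_mass L Y = det (principal_submatrix W Y) / det (W + 1\<^sub>m n)
        \<and> l_ensemble_mass L Y = (vol (N * n) col_obs Y)\<^sup>2 / det (W + 1\<^sub>m n))
    \<and> (\<forall>Y. Y \<subseteq> {..<n} \<longrightarrow>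
          (l_ensemble_mass L Y > 0 \<longleftrightarrow> lin_indpt_family (N * n) col_obs Y))
    \<and> (observable N A C \<longleftrightarrow> (\<forall>Y. Y \<subseteq> {..<n} \<longrightarrow> l_ensemble_mass L Y > 0))"
proof -
  have V: "obs \<in> carrier_mat (N * n) n" and dimA: "dim_row A = n" "dim_row C = n"
    using assms(1,2,4) by (auto simp: obs_matrix_def)
  have W: "W = transpose_mat obs * obs" using assms(4,5) by (simp add: obs_gramian_def)
  have Wc: "W \<in> carrier_mat n n" using V by (simp add: W)
  have col_obs: "col_obs = col obs" using assms(7) by simp
  have "n \<le> N * n" using assms(3) by simp
  then have vol: "(vol (N * n) col_obs Y)\<^sup>2 = det (principal_submatrix W Y)" if "Y \<subseteq> {..<n}" for Y
    unfolding W col_obs by (rule vol_columns[OF V that])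
  then have minor_nonneg: "0 \<le> det (principal_submatrix W Y)" if "Y \<subseteq> {..<n}" for Y
    by (metis that zero_le_power2)
  \<comment> \<open>The empty minor keeps the normalizing constant positive even if every other
    minor vanishes; the others are nonnegative as squared volumes.\<close>
  have "det (principal_submatrix W {}) = 1"
    by (simp add: principal_submatrix_eq[OF Wc])
  moreover have "det (principal_submatrix W {}) \<le> (\<Sum>Y\<in>Pow {..<n}. det (principal_submatrix W Y))"
    by (rule member_le_sum) (auto intro: minor_nonneg)
  ultimately have det_pos: "0 < det (W + 1\<^sub>m n)"
    by (simp add: det_add_one[OF Wc])
  have mass: "l_ensemble_mass L Y = det (principal_submatrix W Y) / det (W + 1\<^sub>m n)" for Y
    using Wc by (simp add: l_ensemble_mass_def assms(6) det_add_one[OF Wc])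
  have nonneg: "0 \<le> l_ensemble_mass L Y" if "Y \<subseteq> {..<n}" for Y
    using minor_nonneg[OF that] det_pos by (simp add: mass)
  have sum1: "(\<Sum>Y \<in> Pow {..<n}. l_ensemble_mass L Y) = 1"
    using det_pos by (simp add: mass sum_divide_distrib[symmetric] det_add_one[OF Wc, symmetric])
  have pos_iff: "l_ensemble_mass L Y > 0 \<longleftrightarrow> lin_indpt_family (N * n) col_obs Y" if "Y \<subseteq> {..<n}" for Y
    using lin_indpt_columns_iff[OF V that] minor_nonneg[OF that] det_pos
    by (simp add: mass W[symmetric] col_obs zero_less_divide_iff less_le)
  have "prob_space (l_ensemble L)"
  proof (rule prob_spaceI)
    have "emeasure (l_ensemble L) (Pow {..<n}) = (\<Sum>Y\<in>Pow {..<n}. ennreal (l_ensemble_mass L Y))"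
      unfolding l_ensemble_def using Wc assms(6) by (subst emeasure_point_measure_finite) auto
    also have "\<dots> = ennreal (\<Sum>Y\<in>Pow {..<n}. l_ensemble_mass L Y)"
      by (rule sum_ennreal) (use nonneg in auto)
    finally show "emeasure (l_ensemble L) (space (l_ensemble L)) = 1"
      using sum1 Wc assms(6) by (simp add: l_ensemble_def space_point_measure)
  qed
  moreover have "pos_semidef L" using pos_semidef_gram[OF V] by (simp add: assms(6) W)
  \<comment> \<open>Positivity for all \<open>Y\<close> includes the full index set, which is full
    column rank. Conversely, independence of all columns passes to every subfamily.\<close>
  moreover have "observable N A C \<longleftrightarrow> (\<forall>Y. Y \<subseteq> {..<n} \<longrightarrow> l_ensemble_mass L Y > 0)"
    using rank_eq_dim_col_iff[OF V] pos_iff lin_indpt_family_subset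
    by (auto simp: observable_def dimA assms(4)[symmetric] col_obs)
  ultimately show ?thesis
    using nonneg sum1 mass vol pos_iff by simp
qed

end
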